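(* Let $X=([1,\infty)\times[1,\infty)\times\{0,+1\})\cap\mathbb{W}$. For all $(\gamma,r,\varepsilon)\in\mathbb{W}$ there exists a non-negative integer $\bar n$ such that $\mathcal{P}_h^{\bar n}(\gamma,r,\varepsilon)\in X$. In particular, the map $\mathcal{T}_h:X\to X$ given by $\mathcal{T}_h(\gamma,r,\varepsilon)=\mathcal{P}_h^{\tau(\gamma,r)}(\gamma,r,\varepsilon)$ with $$\tau(\gamma,r)=\begin{cases}\lfloor\gamma\rfloor+1+n_2\Big(\frac1{1+\lfloor\gamma\rfloor-\gamma},\frac r{(1+\lfloor\gamma\rfloor-\gamma)^2}\Big)&\text{if }\gamma\notin\mathbb{N},\\ \gamma-1&\text{if }\gamma\in\mathbb{N},\end{cases}$$ is well defined. More specifically, for every $(\gamma,r,\varepsilon)\in X$, $$\mathcal{T}_h(\gamma,r,\varepsilon)=\Big(\frac1{1+\lfloor\gamma\rfloor-\gamma},\ \frac r{(1+\lfloor\gamma\rfloor-\gamma)^2},\ \tilde\varepsilon\Big)$$ for some $\tilde\varepsilon\in\{0,+1\}$.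
   Context: $\mathbb{R}^+=(0,\infty)$, $\mathbb{N}=\{1,2,3,\dots\}$, and $\mathcal{P}_h^0$ is the identity. Let $$\mathbb{W}=\{(\gamma,r,\varepsilon)\in\mathbb{R}^+\times\mathbb{R}^+\times\{-1,0,+1\}: r\ge\gamma,\ \varepsilon=0\text{ iff }r=\gamma\}.$$ The map $\mathcal{P}_h:\mathbb{W}\to\mathbb{W}$ (the Poincaré map of the positive horocycle flow on the modular surface for negative times, in suitable coordinates) is given explicitly as follows. If $\varepsilon=+1$: $\mathcal{P}_h(\gamma,r,+1)=(\gamma-1,r,+1)$ if $\gamma>1$; $=(1,r,-1)$ if $\gamma=1$; $=\big(\frac1{1-\gamma},\frac r{(1-\gamma)^2},-1\big)$ if $\gamma<1$, $r>1-\gamma$; $=\big(\frac1{1-\gamma},\frac1{1-\gamma},0\big)$ if $\gamma<1$, $r=1-\gamma$; $=\big(\frac\gamma{1-\gamma},\frac r{(1-\gamma)^2},+1\big)$ if $\gamma<1$, $r<1-\gamma$. If $\varepsilon=-1$: $\mathcal{P}_h(\gamma,r,-1)=\big(\frac\gamma{1+\gamma},\frac r{(1+\gamma)^2},-1\big)$ if $r>\gamma(1+\gamma)$; $=\big(\frac\gamma{1+\gamma},\frac\gamma{1+\gamma},0\big)$ if $r=\gamma(1+\gamma)$; $=(\gamma+1,r,-1)$ if $\gamma>1$, $1+\gamma<r<\gamma(1+\gamma)$; $=(\gamma+1,\gamma+1,0)$ if $\gamma>1$, $r=1+\gamma$; $=(\gamma,r,+1)$ if $r<\min\{1+\gamma,\gamma(1+\gamma)\}$.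 If $\varepsilon=0$ (so $r=\gamma$): $\mathcal{P}_h(\gamma,\gamma,0)=(\gamma-1,\gamma,+1)$ if $\gamma>1$; $=(1,1,0)$ if $\gamma=1$; $=\big(\frac1{1-\gamma},\frac\gamma{(1-\gamma)^2},-1\big)$ if $\frac12<\gamma<1$; $=(2,2,0)$ if $\gamma=\frac12$; $=\big(\frac\gamma{1-\gamma},\frac\gamma{(1-\gamma)^2},+1\big)$ if $\gamma<\frac12$. Stern–Brocot matrices: let $L=\begin{pmatrix}1&0\\1&1\end{pmatrix}$, $R=\begin{pmatrix}1&1\\0&1\end{pmatrix}$. Each positive rational $a/b$ in lowest terms has a unique matrix $M(a/b)$ which is a (possibly empty) product of $L$'s and $R$'s and such that, writing $M(a/b)=\begin{pmatrix} q & p \\ {q'} & {p'} \end{pmatrix}$, one has $a=q+p$ and $b=q'+p'$; it records the path from the root $1/1$ (where $M=I$) to $a/b$ in the Stern–Brocot tree, a step to the left (right) daughter being right multiplication by $L$ (by $R$). For $r>\gamma>0$ define $$n_2(\gamma,r)=2\cdot\#\{(a,b)\in\mathbb{N}^2:\gcd(a,b)=1,\ (q\gamma+p)(q'\gamma+p')<r\}+\#\{(a,b)\in\mathbb{N}^2:\gcd(a,b)=1,\ (q\gamma+p)(q'\gamma+p')=r\}-1,$$ where in each set $p,q,p',q'$ are determined by $(a,b)$ through $M(a/b)=\begin{pmatrix} q & p \\ {q'} & {p'} \end{pmatrix}$. *)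

theory Defs
  imports "HOL-Analysis.Analysis"
begin

definition WW :: "(real \<times> real \<times> int) set" where
  "WW = {(\<gamma>, r, \<epsilon>). \<gamma> > 0 \<and> r > 0 \<and> \<epsilon> \<in> {-1, 0, 1} \<and> r \<ge> \<gamma> \<and> (\<epsilon> = 0 \<longleftrightarrow> r = \<gamma>)}"

text \<open>The cases are mutually exclusive and cover all of \<^const>\<open>WW\<close>;
  only the values on \<^const>\<open>WW\<close> are meaningful.\<close>

definition P_h :: "real \<times> real \<times> int \<Rightarrow> real \<times> real \<times> int" where
  "P_h = (\<lambda>(\<gamma>, r, \<epsilon>).
    if \<epsilon> = 1 then
      (if \<gamma> > 1 then (\<gamma> - 1, r, 1)
       else if \<gamma> = 1 then (1, r, -1)
       else if \<gamma> < 1 \<and> r > 1 - \<gamma> then (1 / (1 - \<gamma>), r / (1 - \<gamma>)^2, -1)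
       else if \<gamma> < 1 \<and> r = 1 - \<gamma> then (1 / (1 - \<gamma>), 1 / (1 - \<gamma>), 0)
       else if \<gamma> < 1 \<and> r < 1 - \<gamma> then (\<gamma> / (1 - \<gamma>), r / (1 - \<gamma>)^2, 1)
       else undefined)
    else if \<epsilon> = -1 then
      (if r > \<gamma> * (1 + \<gamma>) then (\<gamma> / (1 + \<gamma>), r / (1 + \<gamma>)^2, -1)
       else if r = \<gamma> * (1 + \<gamma>) then (\<gamma> / (1 + \<gamma>), \<gamma> / (1 + \<gamma>), 0)
       else if \<gamma> > 1 \<and> 1 + \<gamma> < r \<and> r < \<gamma> * (1 + \<gamma>) then (\<gamma> + 1, r, -1)
       else if \<gamma> > 1 \<and> r = 1 + \<gamma> then (\<gamma> + 1, \<gamma> + 1, 0)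
       else if r < min (1 + \<gamma>) (\<gamma> * (1 + \<gamma>)) then (\<gamma>, r, 1)
       else undefined)
    else if \<epsilon> = 0 then
      (if \<gamma> > 1 then (\<gamma> - 1, \<gamma>, 1)
       else if \<gamma> = 1 then (1, 1, 0)
       else if 1 / 2 < \<gamma> \<and> \<gamma> < 1 then (1 / (1 - \<gamma>), \<gamma> / (1 - \<gamma>)^2, -1)
       else if \<gamma> = 1 / 2 then (2, 2, 0)
       else if \<gamma> < 1 / 2 then (\<gamma> / (1 - \<gamma>), \<gamma> / (1 - \<gamma>)^2, 1)
       else undefined)
    else undefined)"

definition SB_L :: "nat^2^2" where
  "SB_L = vector [vector [1, 0], vector [1, 1]]"

definition SB_R :: "nat^2^2" where
  "SB_R = vector [vector [1, 1], vector [0, 1]]"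

inductive_set SB_products :: "(nat^2^2) set" where
  SB_one: "mat 1 \<in> SB_products"
| SB_left: "A \<in> SB_products \<Longrightarrow> A ** SB_L \<in> SB_products"
| SB_right: "A \<in> SB_products \<Longrightarrow> A ** SB_R \<in> SB_products"

text \<open>The matrix attached to the positive rational a/b in lowest terms; it is only used for
  positive coprime \<open>a\<close>, \<open>b\<close>, where the description determines it uniquely.\<close>

definition SB_matrix :: "nat \<Rightarrow> nat \<Rightarrow> nat^2^2" where
  "SB_matrix a b = (THE A. A \<in> SB_products \<and> a = A$1$1 + A$1$2 \<and> b = A$2$1 + A$2$2)"

definition SB_value :: "real \<Rightarrow> nat \<Rightarrow> nat \<Rightarrow> real" where
  "SB_value \<gamma> a b = (let A = SB_matrix a b; q = real (A$1$1); p = real (A$1$2);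
                         q' = real (A$2$1); p' = real (A$2$2)
                     in (q * \<gamma> + p) * (q' * \<gamma> + p'))"

definition SB_less :: "real \<Rightarrow> real \<Rightarrow> (nat \<times> nat) set" where
  "SB_less \<gamma> r = {(a, b). a > 0 \<and> b > 0 \<and> gcd a b = 1 \<and> SB_value \<gamma> a b < r}"

definition SB_eq :: "real \<Rightarrow> real \<Rightarrow> (nat \<times> nat) set" where
  "SB_eq \<gamma> r = {(a, b). a > 0 \<and> b > 0 \<and> gcd a b = 1 \<and> SB_value \<gamma> a b = r}"

definition n2 :: "real \<Rightarrow> real \<Rightarrow> int" where
  "n2 \<gamma> r = 2 * int (card (SB_less \<gamma> r)) + int (card (SB_eq \<gamma> r)) - 1"

definition XX :: "(real \<times> real \<times> int) set" where
  "XX = ({1..} \<times> {1..} \<times> {0, 1}) \<inter> WW"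

text \<open>In the second branch \<open>\<gamma>\<close> is an integer, so the value is \<open>\<gamma> - 1\<close>.\<close>

definition tau :: "real \<Rightarrow> real \<Rightarrow> int" where
  "tau \<gamma> r =
    (if \<gamma> \<notin> \<nat> then \<lfloor>\<gamma>\<rfloor> + 1 + n2 (1 / (1 + real_of_int \<lfloor>\<gamma>\<rfloor> - \<gamma>)) (r / (1 + real_of_int \<lfloor>\<gamma>\<rfloor> - \<gamma>)^2)
     else \<lfloor>\<gamma>\<rfloor> - 1)"

text \<open>The truncation \<^const>\<open>nat\<close> is harmless only where \<open>tau \<gamma> r \<ge> 0\<close>; this is
  part of the well-definedness of the map.\<close>

definition T_h :: "real \<times> real \<times> int \<Rightarrow> real \<times> real \<times> int" where
  "T_h = (\<lambda>(\<gamma>, r, \<epsilon>). (P_h ^^ nat (tau \<gamma> r)) (\<gamma>, r, \<epsilon>))"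

end

theory Submission
  imports Defs
begin

text \<open>In the variable \<open>\<gamma>\<close>, right multiplication of a Stern--Brocot matrix by \<open>L\<close> or \<open>R\<close> is the
  substitution \<open>\<gamma> \<mapsto> \<gamma>/(1+\<gamma>)\<close> or \<open>\<gamma> \<mapsto> \<gamma>+1\<close> (up to the factor \<open>(1+\<gamma>)\<^sup>2\<close>). Hence the weighted
  count \<open>m = n\<^sub>2 + 1\<close> satisfies \<open>m(\<gamma>, r) = 2 + m(\<gamma>/(1+\<gamma>), r/(1+\<gamma>)\<^sup>2) + m(\<gamma>+1, r)\<close> for \<open>r > \<gamma>\<close>,
  while \<open>m(\<gamma>,\<gamma>) = 1\<close> and \<open>m(\<gamma>, r) = 0\<close> for \<open>r < \<gamma>\<close>. The orbit of \<open>(\<gamma>, r, -1)\<close> traverses this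
  binary tree depth-first, left subtree first, so that it reaches \<open>(\<gamma>, r, +1)\<close> after exactly
  \<open>m(\<gamma>, r) - 1\<close> steps. The remaining orbit segments are iterations of \<open>\<gamma> \<mapsto> \<gamma>-1\<close> and of
  \<open>1/\<gamma> \<mapsto> 1/\<gamma> - 1\<close>.\<close>

section \<open>Stern--Brocot matrices\<close>

declare One_nat_def [simp del]

lemma SB_L_entries: "SB_L$1$1 = 1" "SB_L$1$2 = 0" "SB_L$2$1 = 1" "SB_L$2$2 = 1"
  by (simp_all add: SB_L_def)

lemma SB_R_entries: "SB_R$1$1 = 1" "SB_R$1$2 = 1" "SB_R$2$1 = 0" "SB_R$2$2 = 1"
  by (simp_all add: SB_R_def)

lemma mat1_entries:
  "(mat 1 :: nat^2^2)$1$1 = 1" "(mat 1 :: nat^2^2)$1$2 = 0"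
  "(mat 1 :: nat^2^2)$2$1 = 0" "(mat 1 :: nat^2^2)$2$2 = 1"
  by (simp_all add: mat_def)

lemma matrix_mult_entry_2:
  fixes A B :: "nat^2^2"
  shows "(A ** B)$i$j = A$i$1 * B$1$j + A$i$2 * B$2$j"
  by (simp add: matrix_matrix_mult_def sum_2)

lemmas SB_entries = SB_L_entries SB_R_entries mat1_entries matrix_mult_entry_2

lemma matrix_eq_iff_2:
  fixes A B :: "'a^2^2"
  shows "A = B \<longleftrightarrow> A$1$1 = B$1$1 \<and> A$1$2 = B$1$2 \<and> A$2$1 = B$2$1 \<and> A$2$2 = B$2$2"
  by (auto simp: vec_eq_iff forall_2)

text \<open>\<open>SB_L\<close> and \<open>SB_R\<close> have determinant one, so every product has.
  The identity is written additively because the entries are natural numbers.\<close>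

lemma SB_products_det:
  "A \<in> SB_products \<Longrightarrow> A$1$1 * A$2$2 = Suc (A$1$2 * A$2$1)"
  by (induction rule: SB_products.induct) (simp_all add: SB_entries algebra_simps)

lemma SB_products_diagonal_pos:
  assumes "A \<in> SB_products"
  shows "A$1$1 > 0" "A$2$2 > 0"
  using SB_products_det[OF assms] by (auto intro!: Nat.gr0I)

text \<open>The inductive set appends factors on the right, whereas the Euclidean algorithm on row
  sums strips them on the left; associativity reconciles the two.\<close>

lemma SB_products_left_mult:
  assumes "A \<in> SB_products"
  shows "SB_L ** A \<in> SB_products" "SB_R ** A \<in> SB_products"
proof -
  have "SB_L ** A \<in> SB_products \<and> SB_R ** A \<in> SB_products"
    using assms
  proof (induction rule: SB_products.induct)
    case SB_one
    show ?case
      using SB_left[OF SB_products.SB_one] SB_right[OF SB_products.SB_one] by simp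
  next
    case (SB_left A)
    then show ?case by (simp add: matrix_mul_assoc SB_products.intros)
  next
    case (SB_right A)
    then show ?case by (simp add: matrix_mul_assoc SB_products.intros)
  qed
  then show "SB_L ** A \<in> SB_products" "SB_R ** A \<in> SB_products" by auto
qed

lemma SB_products_left_cases:
  assumes "A \<in> SB_products"
  shows "A = mat 1 \<or> (\<exists>B\<in>SB_products. A = SB_L ** B) \<or> (\<exists>B\<in>SB_products. A = SB_R ** B)"
  using assms
proof (induction rule: SB_products.induct)
  case SB_one
  show ?case by simp
next
  case (SB_left A)
  then show ?case
    by (metis SB_products.SB_one SB_products.SB_left matrix_mul_assoc matrix_mul_lid matrix_mul_rid)
next
  case (SB_right A)
  then show ?case
    by (metis SB_products.SB_one SB_products.SB_right matrix_mul_assoc matrix_mul_lid matrix_mul_rid)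
qed

text \<open>This is \<open>A\<close> applied to the column (1,1), i.e. the fraction a/b as a pair. A
  left factor \<open>SB_L\<close> or \<open>SB_R\<close> adds one component to the other, which
  reverses a step of the subtractive Euclidean algorithm.\<close>

definition row_sums :: "nat^2^2 \<Rightarrow> nat \<times> nat" where
  "row_sums A = (A$1$1 + A$1$2, A$2$1 + A$2$2)"

lemma row_sums_mat1: "row_sums (mat 1) = (1, 1)"
  and row_sums_L: "row_sums (SB_L ** A) = (fst (row_sums A), fst (row_sums A) + snd (row_sums A))"
  and row_sums_R: "row_sums (SB_R ** A) = (fst (row_sums A) + snd (row_sums A), snd (row_sums A))"
  by (simp_all add: row_sums_def SB_entries)

lemma row_sums_pos:
  assumes "A \<in> SB_products"
  shows "fst (row_sums A) > 0" "snd (row_sums A) > 0"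
  using SB_products_diagonal_pos[OF assms] by (simp_all add: row_sums_def)

lemma row_sums_coprime:
  assumes "A \<in> SB_products"
  shows "coprime (fst (row_sums A)) (snd (row_sums A))"
proof (rule coprimeI)
  fix d assume d: "d dvd fst (row_sums A)" "d dvd snd (row_sums A)"
  \<comment> \<open>The determinant identity, with \<open>A$1$2 * A$2$2\<close> added on both sides,
    is a Bezout relation between the row sums.\<close>
  have "fst (row_sums A) * A$2$2 = 1 + snd (row_sums A) * A$1$2"
    using SB_products_det[OF assms] by (simp add: row_sums_def algebra_simps)
  then show "is_unit d"
    by (metis d dvd_add_left_iff dvd_mult2)
qed

text \<open>The row sums reveal the first factor: they are (1,1) for the identity, the second is
  larger after \<open>SB_L\<close>, the first after \<open>SB_R\<close>. Stripping that factor
  lowers the total, so induction on the total applies.\<close>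

lemma inj_on_row_sums: "inj_on row_sums SB_products"
proof -
  have "A = B" if "A \<in> SB_products" "B \<in> SB_products" "row_sums A = row_sums B" for A B
    using that
  proof (induction "fst (row_sums A) + snd (row_sums A)" arbitrary: A B rule: less_induct)
    case less
    have IH: "A' = B'"
      if "A' \<in> SB_products" "B' \<in> SB_products" "row_sums A' = row_sums B'"
        "A = SB_L ** A' \<or> A = SB_R ** A'" for A' B'
    proof (rule less.hyps[OF _ that(1-3)])
      show "fst (row_sums A') + snd (row_sums A') < fst (row_sums A) + snd (row_sums A)"
        using that(4) row_sums_pos[OF that(1)] by (auto simp: row_sums_L row_sums_R)
    qed
    note pos = row_sums_pos
    show ?case
    proof (cases rule: disjE[OF SB_products_left_cases[OF less.prems(1)]])
      case 1
      then have sums: "row_sums B = (1, 1)" using less.prems(3) by (simp add: row_sums_mat1)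
      have "row_sums (SB_L ** B') \<noteq> (1, 1)" "row_sums (SB_R ** B') \<noteq> (1, 1)"
        if "B' \<in> SB_products" for B'
        using pos[OF that] by (simp_all add: row_sums_L row_sums_R)
      then show ?thesis
        using 1 sums SB_products_left_cases[OF less.prems(2)] by blast
    next
      case 2
      then obtain A' where A': "A' \<in> SB_products" "A = SB_L ** A' \<or> A = SB_R ** A'" by blast
      note posA = pos[OF A'(1)]
      have "B \<noteq> mat 1"
        using A'(2) less.prems(3) posA by (auto simp: row_sums_L row_sums_R row_sums_mat1)
      then obtain B' where B': "B' \<in> SB_products" "B = SB_L ** B' \<or> B = SB_R ** B'"
        using SB_products_left_cases[OF less.prems(2)] by blast
      note posB = pos[OF B'(1)]
      have "A = SB_L ** A' \<and> B = SB_L ** B' \<or> A = SB_R ** A' \<and> B = SB_R ** B'"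
        and "row_sums A' = row_sums B'"
        using A'(2) B'(2) less.prems(3) posA posB
        by (auto simp: row_sums_L row_sums_R prod_eq_iff)
      then show ?thesis using IH[OF A'(1) B'(1) _ A'(2)] by auto
    qed
  qed
  then show ?thesis by (auto intro: inj_onI)
qed

text \<open>Subtractive Euclid: the smaller entry is subtracted from the larger until both are 1,
  and each subtraction is recorded as a left factor.\<close>

lemma row_sums_surj:
  assumes "coprime a b" "a > 0" "b > 0"
  shows "\<exists>A\<in>SB_products. row_sums A = (a, b)"
  using assms
proof (induction "a + b" arbitrary: a b rule: less_induct)
  case less
  consider "a = b" | "a < b" | "b < a" by linarith
  then show ?case
  proof cases
    case 1
    then have "a = 1" "b = 1" using less.prems by auto
    then show ?thesis using SB_products.SB_one row_sums_mat1 by metis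
  next
    case 2
    have "\<exists>A\<in>SB_products. row_sums A = (a, b - a)"
    proof (rule less.hyps)
      show "coprime a (b - a)"
        using less.prems(1) 2
        by (metis coprime_iff_gcd_eq_1 gcd.commute gcd_diff1_nat less_imp_le)
    qed (use 2 less.prems in auto)
    then obtain A where "A \<in> SB_products" "row_sums A = (a, b - a)" by blast
    then show ?thesis
      using 2 by (intro bexI[of _ "SB_L ** A"]) (auto simp: row_sums_L SB_products_left_mult)
  next
    case 3
    have "\<exists>A\<in>SB_products. row_sums A = (a - b, b)"
    proof (rule less.hyps)
      show "coprime (a - b) b"
        using less.prems(1) 3
        by (metis coprime_iff_gcd_eq_1 gcd_diff1_nat less_imp_le)
    qed (use 3 less.prems in auto)
    then obtain A where "A \<in> SB_products" "row_sums A = (a - b, b)" by blast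
    then show ?thesis
      using 3 by (intro bexI[of _ "SB_R ** A"]) (auto simp: row_sums_R SB_products_left_mult)
  qed
qed

text \<open>Injectivity of \<open>row_sums\<close> gives the uniqueness that the definite
  description requires.\<close>

lemma SB_matrix_row_sums:
  assumes "A \<in> SB_products" "row_sums A = (a, b)"
  shows "SB_matrix a b = A"
  unfolding SB_matrix_def
proof (rule the_equality)
  show "A \<in> SB_products \<and> a = A$1$1 + A$1$2 \<and> b = A$2$1 + A$2$2"
    using assms by (simp add: row_sums_def)
  show "B = A" if "B \<in> SB_products \<and> a = B$1$1 + B$1$2 \<and> b = B$2$1 + B$2$2" for B
    using inj_onD[OF inj_on_row_sums, of B A] assms that by (simp add: row_sums_def)
qed

section \<open>The counting function\<close>

text \<open>The product of the two components of \<open>A\<close> applied to the column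
  (\<gamma>,1), so that a last factor of \<open>A\<close> can be absorbed into \<gamma>.\<close>

definition SB_form :: "real \<Rightarrow> nat^2^2 \<Rightarrow> real" where
  "SB_form \<gamma> A = (real (A$1$1) * \<gamma> + real (A$1$2)) * (real (A$2$1) * \<gamma> + real (A$2$2))"

lemma SB_form_mat1: "SB_form \<gamma> (mat 1) = \<gamma>"
  by (simp add: SB_form_def SB_entries)

lemma SB_form_R: "SB_form \<gamma> (A ** SB_R) = SB_form (\<gamma> + 1) A"
  by (simp add: SB_form_def SB_entries algebra_simps)

text \<open>\<open>SB_L\<close> sends the column (\<gamma>,1) to (\<gamma>,1+\<gamma>), which is
  1+\<gamma> times the column (\<gamma>/(1+\<gamma>),1); each of the two linear factors contributes
  one scalar.\<close>

lemma SB_form_L: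
  assumes "\<gamma> > 0"
  shows "SB_form \<gamma> (A ** SB_L) = (1 + \<gamma>)\<^sup>2 * SB_form (\<gamma> / (1 + \<gamma>)) A"
proof -
  have linear: "x * \<gamma> + y * (1 + \<gamma>) = (1 + \<gamma>) * (x * (\<gamma> / (1 + \<gamma>)) + y)" for x y :: real
    using assms by (simp add: field_simps)
  have "SB_form \<gamma> (A ** SB_L) =
      (real (A$1$1) * \<gamma> + real (A$1$2) * (1 + \<gamma>)) * (real (A$2$1) * \<gamma> + real (A$2$2) * (1 + \<gamma>))"
    by (simp add: SB_form_def SB_entries algebra_simps)
  then show ?thesis
    unfolding linear SB_form_def power2_eq_square by (simp only: mult_ac)
qed

lemma SB_form_L_compare:
  assumes "\<gamma> > 0"
  shows "SB_form \<gamma> (A ** SB_L) < r \<longleftrightarrow> SB_form (\<gamma> / (1 + \<gamma>)) A < r / (1 + \<gamma>)\<^sup>2"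
    and "SB_form \<gamma> (A ** SB_L) = r \<longleftrightarrow> SB_form (\<gamma> / (1 + \<gamma>)) A = r / (1 + \<gamma>)\<^sup>2"
  using assms unfolding SB_form_L[OF assms] by (simp_all add: field_simps)

text \<open>The last factor moves into the argument, so the induction runs over all \<gamma>: ending
  in \<open>SB_L\<close> gives at least \<gamma> + \<gamma>*\<gamma>, ending in \<open>SB_R\<close>
  at least \<gamma> + 1.\<close>

lemma SB_form_gt:
  assumes "A \<in> SB_products" "\<gamma> > 0"
  shows "A = mat 1 \<or> SB_form \<gamma> A > \<gamma>"
  using assms
proof (induction arbitrary: \<gamma> rule: SB_products.induct)
  case SB_one
  show ?case by simp
next
  case (SB_left A)
  have "SB_form (\<gamma> / (1 + \<gamma>)) A \<ge> \<gamma> / (1 + \<gamma>)"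
    using SB_left.IH[of "\<gamma> / (1 + \<gamma>)"] SB_left.prems by (auto simp: SB_form_mat1)
  then have "SB_form \<gamma> (A ** SB_L) \<ge> (1 + \<gamma>)\<^sup>2 * (\<gamma> / (1 + \<gamma>))"
    unfolding SB_form_L[OF SB_left.prems] by (intro mult_left_mono) auto
  also have "(1 + \<gamma>)\<^sup>2 * (\<gamma> / (1 + \<gamma>)) = \<gamma> + \<gamma>\<^sup>2"
    using SB_left.prems by (simp add: field_simps power2_eq_square)
  finally show ?case using SB_left.prems by (smt (verit) zero_less_power)
next
  case (SB_right A)
  have "SB_form (\<gamma> + 1) A \<ge> \<gamma> + 1"
    using SB_right.IH[of "\<gamma> + 1"] SB_right.prems by (auto simp: SB_form_mat1)
  then show ?case by (simp add: SB_form_R)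
qed

text \<open>Moves the counting from coprime pairs to matrices. The predicate \<open>P\<close> is
  left arbitrary to serve both the strict and the equality count.\<close>

lemma SB_set_conv_image:
  "{(a, b). a > 0 \<and> b > 0 \<and> gcd a b = 1 \<and> P (SB_value \<gamma> a b)}
    = row_sums ` {A \<in> SB_products. P (SB_form \<gamma> A)}" (is "?S = ?T")
proof -
  have form: "SB_value \<gamma> a b = SB_form \<gamma> A" if "A \<in> SB_products" "row_sums A = (a, b)" for a b A
    using SB_matrix_row_sums[OF that] by (simp add: SB_value_def SB_form_def Let_def)
  have "(a, b) \<in> ?S \<longleftrightarrow> (a, b) \<in> ?T" for a b
  proof
    assume "(a, b) \<in> ?S"
    then have ab: "coprime a b" "a > 0" "b > 0" "P (SB_value \<gamma> a b)"
      by (auto simp: coprime_iff_gcd_eq_1)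
    from row_sums_surj[OF ab(1-3)] obtain A where "A \<in> SB_products" "row_sums A = (a, b)" by blast
    then show "(a, b) \<in> ?T"
      using ab(4) form by (metis (mono_tags, lifting) image_eqI mem_Collect_eq)
  next
    assume "(a, b) \<in> ?T"
    then obtain A where A: "A \<in> SB_products" "row_sums A = (a, b)" "P (SB_form \<gamma> A)" by auto
    then show "(a, b) \<in> ?S"
      using row_sums_pos[OF A(1)] row_sums_coprime[OF A(1)] form[OF A(1,2)]
      by (simp add: coprime_iff_gcd_eq_1)
  qed
  then show ?thesis by (intro set_eqI) (simp only: split_paired_all)
qed

lemma SB_form_ge_row_sums:
  assumes "A \<in> SB_products" "\<gamma> > 0"
  shows "SB_form \<gamma> A \<ge> (min \<gamma> 1)\<^sup>2 * (real (fst (row_sums A)) * real (snd (row_sums A)))"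
proof -
  let ?m = "min \<gamma> 1"
  have linear: "real x * \<gamma> + real y \<ge> ?m * real (x + y)" for x y
    using mult_left_mono[of ?m \<gamma> "real x"] mult_left_mono[of ?m 1 "real y"]
    by (simp add: algebra_simps)
  have "(?m * real (A$1$1 + A$1$2)) * (?m * real (A$2$1 + A$2$2)) \<le> SB_form \<gamma> A"
    unfolding SB_form_def using assms(2) by (intro mult_mono linear) auto
  then show ?thesis by (simp add: row_sums_def power2_eq_square mult_ac)
qed

text \<open>A bound on the form bounds the product of the row sums. Both are at least 1, so each is
  bounded, and injectivity of \<open>row_sums\<close> transfers finiteness to the matrices.\<close>

lemma finite_SB_form_le:
  assumes "\<gamma> > 0"
  shows "finite {A \<in> SB_products. SB_form \<gamma> A \<le> r}" (is "finite ?S")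
proof -
  let ?N = "nat \<lceil>r / (min \<gamma> 1)\<^sup>2\<rceil>"
  have "row_sums ` ?S \<subseteq> {..?N} \<times> {..?N}"
  proof (rule image_subsetI)
    fix A assume A: "A \<in> ?S"
    obtain a b where ab: "row_sums A = (a, b)" by fastforce
    have pos: "a > 0" "b > 0" using row_sums_pos[of A] A ab by auto
    have "(min \<gamma> 1)\<^sup>2 * (real a * real b) \<le> r"
      using SB_form_ge_row_sums[of A \<gamma>] A assms ab by simp
    then have "real (a * b) \<le> r / (min \<gamma> 1)\<^sup>2"
      using assms by (simp add: pos_le_divide_eq mult_ac)
    then have "a * b \<le> ?N" by linarith
    moreover have "a \<le> a * b" "b \<le> a * b" using pos by auto
    ultimately have "a \<le> ?N" "b \<le> ?N" by (meson le_trans)+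
    then show "row_sums A \<in> {..?N} \<times> {..?N}" using ab by simp
  qed
  then have "finite (row_sums ` ?S)" by (rule finite_subset) simp
  moreover have "inj_on row_sums ?S" by (rule inj_on_subset[OF inj_on_row_sums]) auto
  ultimately show ?thesis by (simp add: finite_image_iff)
qed

lemma finite_SB_form:
  assumes "\<gamma> > 0"
  shows "finite {A \<in> SB_products. SB_form \<gamma> A < r}" "finite {A \<in> SB_products. SB_form \<gamma> A = r}"
  by (rule finite_subset[OF _ finite_SB_form_le[OF assms, of r]]; auto)+

text \<open>Classifies the products by their last factor, the one that acts on the argument of
  \<open>SB_form\<close>.\<close>

lemma card_SB_products_split:
  assumes fin: "finite {A \<in> SB_products. P A}"
  shows "card {A \<in> SB_products. P A} = (if P (mat 1) then 1 else 0)
    + card {A \<in> SB_products. P (A ** SB_L)} + card {A \<in> SB_products. P (A ** SB_R)}"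
proof -
  let ?I = "if P (mat 1) then {mat 1 :: nat^2^2} else {}"
  let ?L = "{A \<in> SB_products. P (A ** SB_L)}" and ?R = "{A \<in> SB_products. P (A ** SB_R)}"
  let ?mL = "\<lambda>A. A ** SB_L" and ?mR = "\<lambda>A. A ** SB_R"
  have split: "{A \<in> SB_products. P A} = ?I \<union> (?mL ` ?L \<union> ?mR ` ?R)"
  proof (intro equalityI subsetI)
    fix A assume "A \<in> {A \<in> SB_products. P A}"
    then have "A \<in> SB_products" "P A" by auto
    then show "A \<in> ?I \<union> (?mL ` ?L \<union> ?mR ` ?R)"
      by (cases rule: SB_products.cases) auto
  qed (auto intro: SB_products.intros split: if_splits)
  have injL: "inj_on ?mL ?L" and injR: "inj_on ?mR ?R"
    by (auto simp: inj_on_def matrix_eq_iff_2 SB_entries)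
  \<comment> \<open>In the top row of \<open>A ** SB_L\<close> the first entry exceeds the second,
    since \<open>A$1$1\<close> is positive; in that of \<open>B ** SB_R\<close> it does not.\<close>
  have ne: "A ** SB_L \<noteq> mat 1" "A ** SB_R \<noteq> mat 1" "A ** SB_L \<noteq> B ** SB_R"
    if "A \<in> SB_products" for A B
    using SB_products_diagonal_pos[OF that] by (auto simp: matrix_eq_iff_2 SB_entries)
  have disj: "?I \<inter> (?mL ` ?L \<union> ?mR ` ?R) = {}" "?mL ` ?L \<inter> ?mR ` ?R = {}"
    using ne by (auto split: if_splits dest: sym)
  have fin': "finite (?mL ` ?L)" "finite (?mR ` ?R)" "finite ?I"
    using fin unfolding split by auto
  have "card {A \<in> SB_products. P A} = card ?I + (card (?mL ` ?L) + card (?mR ` ?R))"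
    unfolding split card_Un_disjoint[OF fin'(3) finite_UnI[OF fin'(1,2)] disj(1)]
      card_Un_disjoint[OF fin'(1,2) disj(2)] ..
  then show ?thesis by (simp add: card_image injL injR)
qed

section \<open>The weighted count and its recursion\<close>

definition SB_weight :: "real \<Rightarrow> real \<Rightarrow> nat" where
  "SB_weight \<gamma> r = 2 * card {A \<in> SB_products. SB_form \<gamma> A < r}
                  + card {A \<in> SB_products. SB_form \<gamma> A = r}"

lemma finite_SB_less: "\<gamma> > 0 \<Longrightarrow> finite (SB_less \<gamma> r)"
  and finite_SB_eq: "\<gamma> > 0 \<Longrightarrow> finite (SB_eq \<gamma> r)"
  unfolding SB_less_def SB_eq_def
    SB_set_conv_image[of "\<lambda>x. x < r"] SB_set_conv_image[of "\<lambda>x. x = r"]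
  by (simp_all add: finite_SB_form)

lemma n2_conv_SB_weight: "n2 \<gamma> r = int (SB_weight \<gamma> r) - 1"
proof -
  have "inj_on row_sums {A \<in> SB_products. P A}" for P
    by (rule inj_on_subset[OF inj_on_row_sums]) auto
  then show ?thesis
    unfolding n2_def SB_weight_def SB_less_def SB_eq_def
      SB_set_conv_image[of "\<lambda>x. x < r"] SB_set_conv_image[of "\<lambda>x. x = r"]
    by (simp add: card_image)
qed

lemma SB_weight_outside:
  assumes "\<gamma> > 0" "r < \<gamma>"
  shows "SB_weight \<gamma> r = 0"
proof -
  have "SB_form \<gamma> A > r" if "A \<in> SB_products" for A
    using SB_form_gt[OF that assms(1)] assms(2) by (auto simp: SB_form_mat1)
  then show ?thesis by (force simp: SB_weight_def card_eq_0_iff)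
qed

lemma SB_weight_boundary:
  assumes "\<gamma> > 0"
  shows "SB_weight \<gamma> \<gamma> = 1"
proof -
  have "{A \<in> SB_products. SB_form \<gamma> A < \<gamma>} = {}"
    using SB_form_gt[OF _ assms] by (force simp: SB_form_mat1)
  moreover have "{A \<in> SB_products. SB_form \<gamma> A = \<gamma>} = {mat 1}"
    using SB_form_gt[OF _ assms] by (force simp: SB_form_mat1 intro: SB_products.intros)
  ultimately show ?thesis unfolding SB_weight_def by (simp del: Collect_empty_eq)
qed

text \<open>The identity has form value \<gamma> < r and hence contributes 2; products ending in
  \<open>SB_L\<close> and in \<open>SB_R\<close> give the two subtrees.\<close>

lemma SB_weight_rec:
  assumes "\<gamma> > 0" "r > \<gamma>"
  shows "SB_weight \<gamma> r = 2 + SB_weight (\<gamma> / (1 + \<gamma>)) (r / (1 + \<gamma>)\<^sup>2) + SB_weight (\<gamma> + 1) r"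
  using assms(2) unfolding SB_weight_def
  by (subst (1 2) card_SB_products_split)
    (simp_all add: finite_SB_form assms(1) SB_form_mat1 SB_form_R SB_form_L_compare)

section \<open>Orbits of the map\<close>

text \<open>Fractional branches of \<open>P_h\<close> divide the second coordinate by the square of
  a denominator d. This reduces comparisons between the new coordinates to comparisons between the
  old ones.\<close>

lemma divide_compare_square:
  fixes d :: real
  assumes "d > 0"
  shows "a / d < r / d\<^sup>2 \<longleftrightarrow> a * d < r" "r / d\<^sup>2 < a / d \<longleftrightarrow> r < a * d"
    "r / d\<^sup>2 = a / d \<longleftrightarrow> r = a * d"
proof -
  have "a / d = a * d / d\<^sup>2" using assms by (simp add: power2_eq_square)
  moreover have "d\<^sup>2 > 0" using assms by simp
  ultimately show "a / d < r / d\<^sup>2 \<longleftrightarrow> a * d < r" "r / d\<^sup>2 < a / d \<longleftrightarrow> r < a * d"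
    "r / d\<^sup>2 = a / d \<longleftrightarrow> r = a * d"
    by (simp_all only: divide_less_cancel divide_cancel_right) auto
qed

lemma P_h_plus_lt_1:
  assumes "\<gamma> < 1"
  shows "P_h (\<gamma>, r, 1) =
    (if r > 1 - \<gamma> then (1 / (1 - \<gamma>), r / (1 - \<gamma>)\<^sup>2, -1)
     else if r = 1 - \<gamma> then (1 / (1 - \<gamma>), 1 / (1 - \<gamma>), 0)
     else (\<gamma> / (1 - \<gamma>), r / (1 - \<gamma>)\<^sup>2, 1))"
  using assms by (simp add: P_h_def)

lemma P_h_zero_lt_half:
  "\<gamma> < 1 / 2 \<Longrightarrow> P_h (\<gamma>, \<gamma>, 0) = (\<gamma> / (1 - \<gamma>), \<gamma> / (1 - \<gamma>)\<^sup>2, 1)"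
  and P_h_zero_gt_half:
  "1 / 2 < \<gamma> \<Longrightarrow> \<gamma> < 1 \<Longrightarrow> P_h (\<gamma>, \<gamma>, 0) = (1 / (1 - \<gamma>), \<gamma> / (1 - \<gamma>)\<^sup>2, -1)"
  by (simp_all add: P_h_def)

text \<open>Induction on the weight, as the recursion makes both subtrees lighter. Entering the left
  subtree takes one step, and traversing and leaving it takes \<open>?ml\<close>; the step that
  leaves it already enters the right subtree, which then takes \<open>?mr\<close>. The total is 1 +
  \<open>?ml\<close> + \<open>?mr\<close>.\<close>

lemma P_h_return_steps:
  assumes "\<gamma> > 0" "r > \<gamma>"
  shows "(P_h ^^ (SB_weight \<gamma> r - 1)) (\<gamma>, r, -1) = (\<gamma>, r, 1)"
  using assms
proof (induction "SB_weight \<gamma> r" arbitrary: \<gamma> r rule: less_induct)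
  case less
  let ?gl = "\<gamma> / (1 + \<gamma>)" and ?rl = "r / (1 + \<gamma>)\<^sup>2"
  let ?ml = "SB_weight ?gl ?rl" and ?mr = "SB_weight (\<gamma> + 1) r"
  note g = less.prems(1) and r = less.prems(2)
  have rec: "SB_weight \<gamma> r = 2 + ?ml + ?mr" by (rule SB_weight_rec) fact+
  have gl: "0 < ?gl" "?gl < 1" using g by auto
  have gl': "1 - ?gl = 1 / (1 + \<gamma>)" "?gl / (1 - ?gl) = \<gamma>" "?rl / (1 - ?gl)\<^sup>2 = r"
    using g by (auto simp: field_simps)
  have inv: "1 / (1 - ?gl) = \<gamma> + 1" by (simp only: gl'(1)) simp
  have l_lt: "?gl < ?rl \<longleftrightarrow> \<gamma> * (1 + \<gamma>) < r" and l_gt: "?rl < ?gl \<longleftrightarrow> r < \<gamma> * (1 + \<gamma>)"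
    using g by (simp_all add: divide_compare_square)
  have r_lt: "?rl > 1 - ?gl \<longleftrightarrow> r > 1 + \<gamma>" and r_eq: "?rl = 1 - ?gl \<longleftrightarrow> r = 1 + \<gamma>"
    using g by (simp_all add: gl'(1) divide_compare_square)
  \<comment> \<open>The state after the left subtree: the right child if r > 1+\<gamma>, its
    boundary state if r = 1+\<gamma>, and otherwise the goal, because the right subtree is
    empty.\<close>
  define s where "s = (if r > 1 + \<gamma> then (\<gamma> + 1, r, -1) else
    if r = 1 + \<gamma> then (\<gamma> + 1, \<gamma> + 1, 0) else (\<gamma>, r, 1 :: int))"
  have left: "(P_h ^^ (1 + ?ml)) (\<gamma>, r, -1) = s"
  proof -
    consider "r > \<gamma> * (1 + \<gamma>)" | "r = \<gamma> * (1 + \<gamma>)" | "r < \<gamma> * (1 + \<gamma>)" by linarith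
    then show ?thesis
    proof cases
      case 1
      then have "?gl < ?rl" using l_lt by simp
      \<comment> \<open>The left weight is positive, so the truncated subtraction
        \<open>?ml - 1\<close> in the induction hypothesis is exact.\<close>
      then obtain k where k: "?ml = Suc k" using SB_weight_rec[OF gl(1)] by auto
      have "(P_h ^^ (?ml - 1)) (?gl, ?rl, -1) = (?gl, ?rl, 1)"
        using rec gl \<open>?gl < ?rl\<close> by (intro less.hyps) auto
      then have "(P_h ^^ k) (?gl, ?rl, -1) = (?gl, ?rl, 1)" by (simp only: k diff_Suc_1)
      moreover have "P_h (\<gamma>, r, -1) = (?gl, ?rl, -1)" using 1 by (simp add: P_h_def)
      moreover have "P_h (?gl, ?rl, 1) = s"
        by (simp only: P_h_plus_lt_1[OF gl(2)] s_def r_lt r_eq inv gl'(2,3))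
      moreover have "(P_h ^^ (1 + ?ml)) (\<gamma>, r, -1) = P_h ((P_h ^^ k) (P_h (\<gamma>, r, -1)))"
        by (simp only: k plus_1_eq_Suc funpow.simps comp_apply funpow_swap1)
      ultimately show ?thesis by simp
    next
      case 2
      then have "?rl = ?gl" using g by (simp add: divide_compare_square)
      then have "?ml = 1" using SB_weight_boundary[OF gl(1)] by simp
      moreover have "P_h (\<gamma>, r, -1) = (?gl, ?gl, 0)" using 2 by (simp add: P_h_def)
      moreover have "P_h (?gl, ?gl, 0) = s"
      proof -
        \<comment> \<open>Here r = \<gamma>(1+\<gamma>), so comparing r with 1+\<gamma> amounts to
          comparing \<gamma> with 1, and this selects the branch of \<open>P_h\<close> at \<epsilon>
          = 0.\<close>
        have gt1: "1 + \<gamma> < r \<longleftrightarrow> \<gamma> > 1"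
          using g 2 mult_less_cancel_right_pos[of "1 + \<gamma>" 1 \<gamma>] by simp
        have eq1: "1 + \<gamma> = r \<longleftrightarrow> \<gamma> = 1"
          using g 2 mult_cancel_right[of 1 "1 + \<gamma>" \<gamma>] by auto
        have sq: "?gl / (1 - ?gl)\<^sup>2 = r" using gl'(3) by (simp only: \<open>?rl = ?gl\<close>)
        have half: "1 / 2 < ?gl \<longleftrightarrow> \<gamma> > 1" "?gl = 1 / 2 \<longleftrightarrow> \<gamma> = 1"
          using g by (auto simp: field_simps)
        consider "\<gamma> > 1" | "\<gamma> = 1" | "\<gamma> < 1" by linarith
        then show ?thesis
        proof cases
          case 1
          then have "P_h (?gl, ?gl, 0) = (1 / (1 - ?gl), ?gl / (1 - ?gl)\<^sup>2, -1)"
            using gl half by (intro P_h_zero_gt_half) auto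
          moreover have "s = (\<gamma> + 1, r, -1)" using 1 gt1 by (simp add: s_def)
          ultimately show ?thesis by (simp only: sq inv)
        next
          case 2
          then show ?thesis using eq1 by (simp add: P_h_def s_def)
        next
          case 3
          then have "?gl < 1 / 2" using half by linarith
          then have "P_h (?gl, ?gl, 0) = (?gl / (1 - ?gl), ?gl / (1 - ?gl)\<^sup>2, 1)"
            by (rule P_h_zero_lt_half)
          moreover have "s = (\<gamma>, r, 1)" using 3 gt1 eq1 by (auto simp: s_def)
          ultimately show ?thesis by (simp only: sq gl'(2))
        qed
      qed
      ultimately show ?thesis by (simp add: numeral_2_eq_2)
    next
      case 3
      then have "?ml = 0" using SB_weight_outside[OF gl(1)] l_gt by simp
      then have "P_h ^^ (1 + ?ml) = P_h"
        by (simp only: add_0_right One_nat_def funpow.simps comp_id)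
      \<comment> \<open>The branches of \<open>P_h\<close> that move to the right child demand
        \<gamma> > 1; this follows from 1+\<gamma> \<le> r < \<gamma>(1+\<gamma>).\<close>
      moreover have "\<gamma> > 1" if "r \<ge> 1 + \<gamma>"
      proof -
        have "1 * (1 + \<gamma>) < \<gamma> * (1 + \<gamma>)" using that 3 by simp
        then show ?thesis using g by (simp only: mult_less_cancel_right)
      qed
      ultimately show ?thesis using 3 by (auto simp: P_h_def s_def)
    qed
  qed
  have right: "(P_h ^^ ?mr) s = (\<gamma>, r, 1)"
  proof -
    consider "r > 1 + \<gamma>" | "r = 1 + \<gamma>" | "r < 1 + \<gamma>" by linarith
    then show ?thesis
    proof cases
      case 1
      then have gt: "\<gamma> + 1 > 0" "r > \<gamma> + 1" using g by auto
      have "(P_h ^^ (?mr - 1)) (\<gamma> + 1, r, -1) = (\<gamma> + 1, r, 1)"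
        using rec gt by (intro less.hyps) auto
      moreover have "P_h (\<gamma> + 1, r, 1) = (\<gamma>, r, 1)" using g by (simp add: P_h_def)
      moreover have "?mr = Suc (?mr - 1)" using SB_weight_rec[OF gt] by simp
      ultimately show ?thesis using 1 by (simp add: s_def) (metis comp_apply funpow.simps(2))
    next
      case 2
      then have "?mr = 1" using SB_weight_boundary[of "\<gamma> + 1"] g by (simp add: add.commute)
      then have "(P_h ^^ ?mr) s = P_h s" by (simp only: One_nat_def funpow.simps comp_id)
      also have "P_h s = (\<gamma>, r, 1)" using 2 g by (simp add: s_def P_h_def)
      finally show ?thesis .
    next
      case 3
      then have "?mr = 0" using SB_weight_outside[of "\<gamma> + 1"] g by simp
      then show ?thesis using 3 by (simp add: s_def)
    qed
  qed
  have "SB_weight \<gamma> r - 1 = ?mr + (1 + ?ml)" using rec by simp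
  then show ?case by (simp only: funpow_add[of ?mr "1 + ?ml"] comp_apply left right)
qed

section \<open>Descent by unit steps and the map \<open>T_h\<close>\<close>

lemma P_h_descend:
  assumes "\<gamma> > real n"
  shows "(P_h ^^ n) (\<gamma>, r, 1) = (\<gamma> - real n, r, 1)"
  using assms
proof (induction n)
  case (Suc n)
  then show ?case by (simp add: P_h_def)
qed simp

lemma P_h_descend_0:
  assumes "n > 0" "\<gamma> > real n"
  shows "(P_h ^^ n) (\<gamma>, \<gamma>, 0) = (\<gamma> - real n, \<gamma>, 1)"
proof -
  obtain k where k: "n = Suc k" using assms(1) gr0_conv_Suc by auto
  have "P_h (\<gamma>, \<gamma>, 0) = (\<gamma> - 1, \<gamma>, 1)" using assms k by (simp add: P_h_def)
  moreover have "(P_h ^^ k) (\<gamma> - 1, \<gamma>, 1) = (\<gamma> - 1 - real k, \<gamma>, 1)"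
    using assms k by (intro P_h_descend) auto
  ultimately show ?thesis by (simp add: k funpow_swap1 algebra_simps)
qed

text \<open>The first step already turns \<epsilon> = 0 into 1, so only for n = 0 does the starting
  sign matter.\<close>

lemma XX_descend:
  assumes "(\<gamma>, r, \<epsilon>) \<in> XX" "\<gamma> > real n" "n > 0 \<or> \<epsilon> = 1"
  shows "(P_h ^^ n) (\<gamma>, r, \<epsilon>) = (\<gamma> - real n, r, 1)"
proof (cases "\<epsilon> = 1")
  case True
  then show ?thesis using assms P_h_descend by simp
next
  case False
  then have "\<epsilon> = 0" "r = \<gamma>" using assms(1) by (auto simp: XX_def WW_def)
  then show ?thesis using assms P_h_descend_0 by simp
qed

text \<open>Here d is 1 minus the fractional part of \<gamma>, strictly between 0 and 1 for
  non-integral \<gamma>. The last bound amounts to d < r, which holds as d < 1 \<le> r.\<close>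

lemma one_minus_frac_bounds:
  fixes \<gamma> :: real
  assumes "\<gamma> \<ge> 1" "r \<ge> \<gamma>" "\<gamma> \<notin> \<nat>"
  defines "d \<equiv> 1 + real_of_int \<lfloor>\<gamma>\<rfloor> - \<gamma>"
  shows "0 < d" "d < 1" "1 < 1 / d" "1 / d < r / d\<^sup>2"
proof -
  have "\<gamma> \<noteq> real_of_int \<lfloor>\<gamma>\<rfloor>"
  proof
    assume "\<gamma> = real_of_int \<lfloor>\<gamma>\<rfloor>"
    then have "\<gamma> = real (nat \<lfloor>\<gamma>\<rfloor>)" using assms(1) by linarith
    then show False using assms(3) by (metis of_nat_in_Nats)
  qed
  then show d: "0 < d" "d < 1" unfolding d_def by linarith+
  then show "1 < 1 / d" by simp
  show "1 / d < r / d\<^sup>2" using d assms(1,2) by (simp add: divide_compare_square)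
qed

text \<open>The three summands of \<open>tau\<close> are three orbit segments: floor of \<gamma>
  unit subtractions, one step to \<epsilon> = -1 at the target coordinates, and \<open>n2\<close>
  steps that return there with \<epsilon> = 1.\<close>

lemma T_h_nonint:
  assumes X: "(\<gamma>, r, \<epsilon>) \<in> XX" and nonint: "\<gamma> \<notin> \<nat>"
  defines "d \<equiv> 1 + real_of_int \<lfloor>\<gamma>\<rfloor> - \<gamma>"
  shows "T_h (\<gamma>, r, \<epsilon>) = (1 / d, r / d\<^sup>2, 1)" "tau \<gamma> r \<ge> 0"
proof -
  have gr: "\<gamma> \<ge> 1" "r \<ge> \<gamma>" using X by (auto simp: XX_def WW_def)
  note d = one_minus_frac_bounds[OF gr nonint, folded d_def]
  define n where "n = nat \<lfloor>\<gamma>\<rfloor>"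
  have n: "n > 0" "real n = real_of_int \<lfloor>\<gamma>\<rfloor>" using gr unfolding n_def by linarith+
  then have dn: "d = 1 - (\<gamma> - real n)" unfolding d_def by simp
  let ?m = "SB_weight (1 / d) (r / d\<^sup>2)"
  \<comment> \<open>Makes \<open>?m - 1\<close> on natural numbers agree with the integer
    \<open>n2\<close>.\<close>
  have m: "?m \<ge> 1" using SB_weight_rec[of "1 / d" "r / d\<^sup>2"] d by simp
  have tau: "tau \<gamma> r = int ((?m - 1) + Suc n)"
    using nonint m n by (simp add: tau_def n2_conv_SB_weight flip: d_def)
  then show "tau \<gamma> r \<ge> 0" by simp
  have "(P_h ^^ n) (\<gamma>, r, \<epsilon>) = (\<gamma> - real n, r, 1)"
    using d(2) dn n(1) by (intro XX_descend[OF X]) auto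
  moreover have "P_h (\<gamma> - real n, r, 1) = (1 / d, r / d\<^sup>2, -1)"
  proof -
    have "\<gamma> - real n < 1" "r > 1 - (\<gamma> - real n)" using d dn gr by linarith+
    then show ?thesis unfolding dn by (simp only: P_h_plus_lt_1 if_True)
  qed
  ultimately have "(P_h ^^ Suc n) (\<gamma>, r, \<epsilon>) = (1 / d, r / d\<^sup>2, -1)" by simp
  moreover have "(P_h ^^ (?m - 1)) (1 / d, r / d\<^sup>2, -1) = (1 / d, r / d\<^sup>2, 1)"
    using d by (intro P_h_return_steps) auto
  ultimately show "T_h (\<gamma>, r, \<epsilon>) = (1 / d, r / d\<^sup>2, 1)"
    unfolding T_h_def by (simp only: prod.case tau nat_int funpow_add comp_apply)
qed

text \<open>Subtracting 1 exactly \<gamma> - 1 times leads to 1. The sign 0 survives only if no step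
  is made, that is, at (1,1,0).\<close>

lemma T_h_int:
  assumes X: "(\<gamma>, r, \<epsilon>) \<in> XX" and int: "\<gamma> \<in> \<nat>"
  shows "T_h (\<gamma>, r, \<epsilon>) = (1, r, if r = 1 then 0 else 1)" "tau \<gamma> r \<ge> 0"
proof -
  have gr: "\<gamma> \<ge> 1" "r \<ge> \<gamma>" and e: "\<epsilon> = (if r = \<gamma> then 0 else 1)"
    using X by (auto simp: XX_def WW_def)
  obtain k where "\<gamma> = real k" using int by (auto elim: Nats_cases)
  then obtain n where n: "\<gamma> = real n + 1" using gr(1) by (cases k) auto
  then have tau: "tau \<gamma> r = int n" using int by (simp add: tau_def)
  then show "tau \<gamma> r \<ge> 0" by simp
  show "T_h (\<gamma>, r, \<epsilon>) = (1, r, if r = 1 then 0 else 1)"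
  proof (cases "n = 0")
    case True
    then show ?thesis using n tau e by (simp add: T_h_def)
  next
    case False
    then show ?thesis using XX_descend[OF X, of n] n tau gr by (simp add: T_h_def)
  qed
qed

section \<open>Reaching \<open>XX\<close> from every point of \<open>WW\<close>\<close>

lemma P_h_reaches_from_minus:
  assumes "\<gamma> \<ge> 1" "r > \<gamma>"
  shows "\<exists>n. (P_h ^^ n) (\<gamma>, r, -1) \<in> XX"
proof
  show "(P_h ^^ (SB_weight \<gamma> r - 1)) (\<gamma>, r, -1) \<in> XX"
    using assms by (subst P_h_return_steps) (auto simp: XX_def WW_def)
qed

lemma P_h_reaches_step:
  assumes "\<exists>n. (P_h ^^ n) (P_h x) \<in> XX"
  shows "\<exists>n. (P_h ^^ n) x \<in> XX"
  using assms by (metis comp_apply funpow_Suc_right)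

lemma P_h_reaches_refl: "x \<in> XX \<Longrightarrow> \<exists>n. (P_h ^^ n) x \<in> XX"
  by (rule exI[of _ 0]) simp

text \<open>The only branch that can be repeated is \<gamma> \<mapsto> \<gamma>/(1-\<gamma>). It
  lowers 1/\<gamma> by exactly 1, so the rounded-up reciprocal is the induction measure; every other
  branch leads to first coordinate at least 1.\<close>

lemma P_h_reaches_from_plus:
  assumes "\<gamma> > 0" "r > \<gamma>"
  shows "\<exists>n. (P_h ^^ n) (\<gamma>, r, 1) \<in> XX"
  using assms
proof (induction "nat \<lceil>1 / \<gamma>\<rceil>" arbitrary: \<gamma> r rule: less_induct)
  case less
  note g = less.prems
  consider "\<gamma> \<ge> 1" | "\<gamma> < 1" "r > 1 - \<gamma>" | "\<gamma> < 1" "r = 1 - \<gamma>" | "\<gamma> < 1" "r < 1 - \<gamma>" by linarith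
  then show ?case
  proof cases
    case 1
    then show ?thesis using g by (intro P_h_reaches_refl) (simp add: XX_def WW_def)
  next
    case 2
    then have "P_h (\<gamma>, r, 1) = (1 / (1 - \<gamma>), r / (1 - \<gamma>)\<^sup>2, -1)"
      by (simp only: P_h_plus_lt_1 if_True)
    moreover have "1 / (1 - \<gamma>) \<ge> 1" "r / (1 - \<gamma>)\<^sup>2 > 1 / (1 - \<gamma>)"
      using 2 g by (simp_all add: divide_compare_square)
    ultimately show ?thesis by - (rule P_h_reaches_step, simp add: P_h_reaches_from_minus)
  next
    case 3
    then have "P_h (\<gamma>, r, 1) = (1 / (1 - \<gamma>), 1 / (1 - \<gamma>), 0)" by (simp add: P_h_plus_lt_1)
    then have "P_h (\<gamma>, r, 1) \<in> XX" using 3 g by (simp add: XX_def WW_def)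
    then show ?thesis by (rule P_h_reaches_step[OF P_h_reaches_refl])
  next
    case 4
    let ?g = "\<gamma> / (1 - \<gamma>)" and ?r = "r / (1 - \<gamma>)\<^sup>2"
    have P: "P_h (\<gamma>, r, 1) = (?g, ?r, 1)" using 4 by (simp only: P_h_plus_lt_1 less_asym less_irrefl if_False) auto
    have inv: "1 / ?g = 1 / \<gamma> - 1" using g 4 by (simp add: field_simps)
    have "\<exists>n. (P_h ^^ n) (?g, ?r, 1) \<in> XX"
    proof (rule less.hyps)
      have "1 / \<gamma> > 0" using g by simp
      then show "nat \<lceil>1 / ?g\<rceil> < nat \<lceil>1 / \<gamma>\<rceil>" unfolding inv by simp
      show "0 < ?g" using g 4 by simp
      have "\<gamma> * \<gamma> > 0" using g by simp
      \<comment> \<open>The new point must again satisfy the strict inequality between its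
        coordinates: \<gamma>(1-\<gamma>) < \<gamma> < r.\<close>
      then have "\<gamma> * (1 - \<gamma>) < r" using g unfolding right_diff_distrib by linarith
      then show "?g < ?r" using 4 by (simp add: divide_compare_square)
    qed
    then show ?thesis by - (rule P_h_reaches_step, simp add: P)
  qed
qed

lemma P_h_reaches_from_zero:
  assumes "\<gamma> > 0"
  shows "\<exists>n. (P_h ^^ n) (\<gamma>, \<gamma>, 0) \<in> XX"
proof -
  consider "\<gamma> \<ge> 1" | "1 / 2 < \<gamma>" "\<gamma> < 1" | "\<gamma> = 1 / 2" | "\<gamma> < 1 / 2" by linarith
  then show ?thesis
  proof cases
    case 1
    then show ?thesis by (intro P_h_reaches_refl) (simp add: XX_def WW_def)
  next
    case 2
    then have "P_h (\<gamma>, \<gamma>, 0) = (1 / (1 - \<gamma>), \<gamma> / (1 - \<gamma>)\<^sup>2, -1)"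
      by (simp only: P_h_zero_gt_half)
    moreover have "1 / (1 - \<gamma>) \<ge> 1" "\<gamma> / (1 - \<gamma>)\<^sup>2 > 1 / (1 - \<gamma>)"
      using 2 by (simp_all add: divide_compare_square)
    ultimately show ?thesis by - (rule P_h_reaches_step, simp add: P_h_reaches_from_minus)
  next
    case 3
    then have "P_h (\<gamma>, \<gamma>, 0) \<in> XX" by (simp add: P_h_def XX_def WW_def)
    then show ?thesis by (rule P_h_reaches_step[OF P_h_reaches_refl])
  next
    case 4
    then have "P_h (\<gamma>, \<gamma>, 0) = (\<gamma> / (1 - \<gamma>), \<gamma> / (1 - \<gamma>)\<^sup>2, 1)"
      by (simp only: P_h_zero_lt_half)
    moreover have "\<gamma> / (1 - \<gamma>) > 0" "\<gamma> / (1 - \<gamma>)\<^sup>2 > \<gamma> / (1 - \<gamma>)"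
      using 4 assms by (simp_all add: divide_compare_square)
    ultimately show ?thesis by - (rule P_h_reaches_step, simp add: P_h_reaches_from_plus)
  qed
qed

lemma P_h_reaches_XX:
  assumes "(\<gamma>, r, \<epsilon>) \<in> WW"
  shows "\<exists>n. (P_h ^^ n) (\<gamma>, r, \<epsilon>) \<in> XX"
proof -
  from assms consider "\<gamma> > 0" "r > \<gamma>" "\<epsilon> = -1" | "\<gamma> > 0" "r = \<gamma>" "\<epsilon> = 0" | "\<gamma> > 0" "r > \<gamma>" "\<epsilon> = 1"
    by (force simp: WW_def)
  then show ?thesis
  proof cases
    case 1
    obtain n where "(P_h ^^ n) (\<gamma>, r, 1) \<in> XX" using P_h_reaches_from_plus[OF 1(1,2)] by blast
    \<comment> \<open>\<gamma> may be below 1 here, so the orbit first returns to the same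
      coordinates with \<epsilon> = 1 and continues from there.\<close>
    then have "(P_h ^^ (n + (SB_weight \<gamma> r - 1))) (\<gamma>, r, -1) \<in> XX"
      by (simp only: funpow_add comp_apply P_h_return_steps[OF 1(1,2)])
    then show ?thesis using 1(3) by blast
  qed (use P_h_reaches_from_zero P_h_reaches_from_plus in auto)
qed

text \<open>Well-definedness is made explicit: the counted sets are finite, as \<open>card\<close>
  is 0 on infinite sets; \<open>tau\<close> is nonnegative, as \<open>nat\<close> truncates; and
  \<open>T_h\<close> maps \<open>XX\<close> into itself.\<close>

theorem theorem6p2:
  "(\<forall>(\<gamma>, r, \<epsilon>) \<in> WW. \<exists>n::nat. (P_h ^^ n) (\<gamma>, r, \<epsilon>) \<in> XX)
   \<and> (\<forall>(\<gamma>, r, \<epsilon>) \<in> XX.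
        (\<gamma> \<notin> \<nat> \<longrightarrow>
           (let \<gamma>' = 1 / (1 + real_of_int \<lfloor>\<gamma>\<rfloor> - \<gamma>); r' = r / (1 + real_of_int \<lfloor>\<gamma>\<rfloor> - \<gamma>)^2
            in 0 < \<gamma>' \<and> \<gamma>' < r' \<and> finite (SB_less \<gamma>' r') \<and> finite (SB_eq \<gamma>' r')))
        \<and> tau \<gamma> r \<ge> 0)
   \<and> T_h \<in> XX \<rightarrow> XX
   \<and> (\<forall>(\<gamma>, r, \<epsilon>) \<in> XX. \<exists>\<epsilon>' \<in> {0, 1}.
        T_h (\<gamma>, r, \<epsilon>) =
          (1 / (1 + real_of_int \<lfloor>\<gamma>\<rfloor> - \<gamma>), r / (1 + real_of_int \<lfloor>\<gamma>\<rfloor> - \<gamma>)^2, \<epsilon>'))"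
proof (intro conjI)
  show "\<forall>(\<gamma>, r, \<epsilon>) \<in> WW. \<exists>n::nat. (P_h ^^ n) (\<gamma>, r, \<epsilon>) \<in> XX"
    using P_h_reaches_XX by auto
next
  show "\<forall>(\<gamma>, r, \<epsilon>) \<in> XX.
        (\<gamma> \<notin> \<nat> \<longrightarrow>
           (let \<gamma>' = 1 / (1 + real_of_int \<lfloor>\<gamma>\<rfloor> - \<gamma>); r' = r / (1 + real_of_int \<lfloor>\<gamma>\<rfloor> - \<gamma>)^2
            in 0 < \<gamma>' \<and> \<gamma>' < r' \<and> finite (SB_less \<gamma>' r') \<and> finite (SB_eq \<gamma>' r')))
        \<and> tau \<gamma> r \<ge> 0"
  proof clarify
    fix \<gamma> r :: real and \<epsilon> :: int
    assume X: "(\<gamma>, r, \<epsilon>) \<in> XX"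
    then have gr: "\<gamma> \<ge> 1" "r \<ge> \<gamma>" by (auto simp: XX_def WW_def)
    show "(\<gamma> \<notin> \<nat> \<longrightarrow>
           (let \<gamma>' = 1 / (1 + real_of_int \<lfloor>\<gamma>\<rfloor> - \<gamma>); r' = r / (1 + real_of_int \<lfloor>\<gamma>\<rfloor> - \<gamma>)^2
            in 0 < \<gamma>' \<and> \<gamma>' < r' \<and> finite (SB_less \<gamma>' r') \<and> finite (SB_eq \<gamma>' r')))
        \<and> tau \<gamma> r \<ge> 0"
      using one_minus_frac_bounds[OF gr] T_h_nonint(2)[OF X] T_h_int(2)[OF X]
      by (auto simp: Let_def finite_SB_less finite_SB_eq)
  qed
next
  have T: "\<exists>\<epsilon>' \<in> {0, 1}.
      T_h (\<gamma>, r, \<epsilon>) = (1 / (1 + real_of_int \<lfloor>\<gamma>\<rfloor> - \<gamma>), r / (1 + real_of_int \<lfloor>\<gamma>\<rfloor> - \<gamma>)^2, \<epsilon>')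
      \<and> T_h (\<gamma>, r, \<epsilon>) \<in> XX" if X: "(\<gamma>, r, \<epsilon>) \<in> XX" for \<gamma> r \<epsilon>
  proof (cases "\<gamma> \<in> \<nat>")
    case True
    \<comment> \<open>For integral \<gamma> the denominator in the general formula is 1, so the
      formula reduces to (1, r).\<close>
    then have "real_of_int \<lfloor>\<gamma>\<rfloor> = \<gamma>" by (metis Nats_cases floor_of_nat of_int_of_nat_eq)
    moreover have "r \<ge> 1" using X by (auto simp: XX_def)
    ultimately show ?thesis using T_h_int(1)[OF X True] by (auto simp: XX_def WW_def)
  next
    case False
    have gr: "\<gamma> \<ge> 1" "r \<ge> \<gamma>" using X by (auto simp: XX_def WW_def)
    let ?d = "1 + real_of_int \<lfloor>\<gamma>\<rfloor> - \<gamma>"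
    have "1 < 1 / ?d" "1 / ?d < r / ?d\<^sup>2" by (rule one_minus_frac_bounds[OF gr False])+
    then have "(1 / ?d, r / ?d\<^sup>2, 1) \<in> XX" unfolding XX_def WW_def by simp linarith
    then show ?thesis unfolding T_h_nonint(1)[OF X False] by blast
  qed
  then show "T_h \<in> XX \<rightarrow> XX" by fastforce
  show "\<forall>(\<gamma>, r, \<epsilon>) \<in> XX. \<exists>\<epsilon>' \<in> {0, 1}.
        T_h (\<gamma>, r, \<epsilon>) =
          (1 / (1 + real_of_int \<lfloor>\<gamma>\<rfloor> - \<gamma>), r / (1 + real_of_int \<lfloor>\<gamma>\<rfloor> - \<gamma>)^2, \<epsilon>')"
    using T by blast
qed

end
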